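(* Let $d\geq 2$, $t\geq 2$ and $\ell\geq 1$ be integers. Let $G=(V,E)$ be an $S_{1^t,\ell}$-free graph with maximum degree $\Delta$ such that either $\Delta = 2$, or both $3\leq \Delta\leq \frac{t}{t-1}d+\frac{1}{t-1}$ and $|V| > (d+1)\left(\frac{\Delta(\Delta-1)^{\ell+1}-2}{\Delta-2}\right)$. Then $G$ has a $d$-cut, and such a $d$-cut can be found in linear time.
   Context: All graphs are finite, simple and undirected. For positive integers $t$ and $\ell$, $S_{1^t,\ell}$ denotes the graph obtained from the star $K_{1,t+1}$ (a centre adjacent to $t+1$ leaves) by replacing one of its edges with a path of length $\ell$ (i.e. subdividing that edge exactly $\ell-1$ times); it has exactly $t+\ell$ edges, and $S_{1^t,1}=K_{1,t+1}$. A graph is $H$-free if it contains no induced subgraph isomorphic to $H$. For an integer $d\geq 1$, a set $M\subseteq E$ is a $d$-cut of $G$ if $V$ can be partitioned into two non-empty sets $B$ and $R$ such that $M$ is exactly the set of edges with one end in $B$ and the other in $R$, and every vertex of $B$ has at most $d$ neighbours in $R$ and every vertex of $R$ has at most $d$ neighbours in $B$. *)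

theory Defs
  imports Complex_Main
begin

section \<open>Finite simple undirected graphs\<close>

definition simple_graph :: "'a set \<Rightarrow> 'a set set \<Rightarrow> bool" where
  "simple_graph V E \<longleftrightarrow> finite V \<and> E \<subseteq> {{u, v} | u v. u \<in> V \<and> v \<in> V \<and> u \<noteq> v}"

definition nbrs :: "'a set set \<Rightarrow> 'a \<Rightarrow> 'a set" where
  "nbrs E v = {u. {v, u} \<in> E}"

definition degree :: "'a set set \<Rightarrow> 'a \<Rightarrow> nat" where
  "degree E v = card (nbrs E v)"

text \<open>The inserted 0 only serves to give the graph without vertices maximum degree 0.\<close>

definition max_degree :: "'a set \<Rightarrow> 'a set set \<Rightarrow> nat" where
  "max_degree V E = Max (insert 0 (degree E ` V))"

definition graph_iso :: "'a set \<Rightarrow> 'a set set \<Rightarrow> 'b set \<Rightarrow> 'b set set \<Rightarrow> bool" where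
  "graph_iso V E V' E' \<longleftrightarrow>
     (\<exists>f. bij_betw f V V' \<and> (\<forall>u\<in>V. \<forall>v\<in>V. {u, v} \<in> E \<longleftrightarrow> {f u, f v} \<in> E'))"

definition induced_edges :: "'a set set \<Rightarrow> 'a set \<Rightarrow> 'a set set" where
  "induced_edges E W = {e \<in> E. e \<subseteq> W}"

definition is_free :: "'b set \<Rightarrow> 'b set set \<Rightarrow> 'a set \<Rightarrow> 'a set set \<Rightarrow> bool" where
  "is_free VH EH V E \<longleftrightarrow> \<not> (\<exists>W \<subseteq> V. graph_iso W (induced_edges E W) VH EH)"


section \<open>The graph $S_{1^t,\ell}$\<close>

text \<open>
  The centre is 0, the leaves at distance 1 are 1, ..., t, and the edge from 0 to t + 1 of the
  star is extended to the path 0, t + 1, t + 2, ..., t + l, which has length l.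
\<close>

definition S_verts :: "nat \<Rightarrow> nat \<Rightarrow> nat set" where
  "S_verts t l = {0..t + l}"

definition S_edges :: "nat \<Rightarrow> nat \<Rightarrow> nat set set" where
  "S_edges t l = {{0, i} | i. 1 \<le> i \<and> i \<le> t + 1} \<union> {{i, i + 1} | i. t + 1 \<le> i \<and> i < t + l}"

lemma S_simple: "l \<ge> 1 \<Longrightarrow> simple_graph (S_verts t l) (S_edges t l)"
proof -
  assume l: "l \<ge> 1"
  have "\<exists>u v. e = {u, v} \<and> u \<in> S_verts t l \<and> v \<in> S_verts t l \<and> u \<noteq> v" if "e \<in> S_edges t l" for e
  proof -
    from that consider i where "e = {0, i}" "1 \<le> i" "i \<le> t + 1"
      | i where "e = {i, i + 1}" "t + 1 \<le> i" "i < t + l"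
      unfolding S_edges_def by blast
    then show ?thesis
    proof cases
      case 1
      with l show ?thesis by (intro exI[of _ 0] exI[of _ i]) (simp add: S_verts_def)
    next
      case 2
      then show ?thesis by (intro exI[of _ i] exI[of _ "i + 1"]) (simp add: S_verts_def)
    qed
  qed
  then show ?thesis by (auto simp: simple_graph_def S_verts_def)
qed

lemma S_star: "S_edges t 1 = {{0, i} | i. 1 \<le> i \<and> i \<le> t + 1}"
  by (auto simp: S_edges_def)

lemma card_S_edges:
  assumes "l \<ge> 1"
  shows "card (S_edges t l) = t + l"
proof -
  have 1: "{{0, i} | i. 1 \<le> i \<and> i \<le> t + 1} = (\<lambda>i. {0::nat, i}) ` {1..t + 1}" by auto
  have 2: "{{i, i + 1} | i. t + 1 \<le> i \<and> i < t + l} = (\<lambda>i. {i::nat, i + 1}) ` {t + 1..<t + l}"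
    by auto
  have "card ((\<lambda>i. {0::nat, i}) ` {1..t + 1}) = t + 1"
    by (subst card_image) (auto simp: inj_on_def doubleton_eq_iff)
  moreover have "card ((\<lambda>i. {i::nat, i + 1}) ` {t + 1..<t + l}) = l - 1"
    by (subst card_image) (auto simp: inj_on_def doubleton_eq_iff)
  moreover have "(\<lambda>i. {0::nat, i}) ` {1..t + 1} \<inter> (\<lambda>i. {i::nat, i + 1}) ` {t + 1..<t + l} = {}"
    by (auto simp: doubleton_eq_iff)
  ultimately show ?thesis
    unfolding S_edges_def 1 2 using assms by (subst card_Un_disjoint) auto
qed


section \<open>$d$-cuts\<close>

definition d_cut :: "nat \<Rightarrow> 'a set \<Rightarrow> 'a set set \<Rightarrow> 'a set set \<Rightarrow> bool" where
  "d_cut d V E M \<longleftrightarrow>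
     M \<subseteq> E \<and>
     (\<exists>B R. B \<noteq> {} \<and> R \<noteq> {} \<and> B \<inter> R = {} \<and> B \<union> R = V \<and>
        M = {e \<in> E. \<exists>b\<in>B. \<exists>r\<in>R. e = {b, r}} \<and>
        (\<forall>b\<in>B. card (nbrs E b \<inter> R) \<le> d) \<and>
        (\<forall>r\<in>R. card (nbrs E r \<inter> B) \<le> d))"

definition admissible :: "nat \<Rightarrow> nat \<Rightarrow> nat \<Rightarrow> 'a set \<Rightarrow> 'a set set \<Rightarrow> bool" where
  "admissible d t l V E \<longleftrightarrow>
     simple_graph V E \<and>
     is_free (S_verts t l) (S_edges t l) V E \<and>
     (let D = real (max_degree V E) in
        D = 2 \<or>
        3 \<le> D \<and>
        D \<le> real t / (real t - 1) * real d + 1 / (real t - 1) \<and>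
        real (card V) > (real d + 1) * ((D * (D - 1) ^ (l + 1) - 2) / (D - 2)))"


section \<open>Linear time\<close>

text \<open>
  Running time is measured on a random access machine, programmed in a small imperative language
  with natural-number variables and arrays (random access memory, initially 0).  Every operation
  costs one time unit.  The only arithmetic is successor and predecessor, so in T steps no stored
  number can exceed the largest number in the input and the program by more than T.  Hence, for
  linear T, all numbers have O(log N) bits on inputs of size N, and the uniform cost measure
  cannot be abused by computing with huge numbers.
\<close>

type_synonym state = "(string \<Rightarrow> nat) \<times> (string \<Rightarrow> nat \<Rightarrow> nat)"

datatype aexp =
    Const nat
  | Var string
  | Get string aexp
  | Inc aexp
  | Dec aexp

datatype bexp =
    Less aexp aexp
  | Equal aexp aexp
  | Not bexp
  | And bexp bexp

datatype com =
    Skip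
  | Assign string aexp
  | Put string aexp aexp
  | Seq com com
  | If bexp com com
  | While bexp com

fun aval :: "aexp \<Rightarrow> state \<Rightarrow> nat" where
  "aval (Const k) s = k"
| "aval (Var x) s = fst s x"
| "aval (Get a e) s = snd s a (aval e s)"
| "aval (Inc e) s = aval e s + 1"
| "aval (Dec e) s = aval e s - 1"

fun bval :: "bexp \<Rightarrow> state \<Rightarrow> bool" where
  "bval (Less e f) s \<longleftrightarrow> aval e s < aval f s"
| "bval (Equal e f) s \<longleftrightarrow> aval e s = aval f s"
| "bval (Not b) s \<longleftrightarrow> \<not> bval b s"
| "bval (And b b') s \<longleftrightarrow> bval b s \<and> bval b' s"

fun acost :: "aexp \<Rightarrow> nat" where
  "acost (Const k) = 1"
| "acost (Var x) = 1"
| "acost (Get a e) = acost e + 1"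
| "acost (Inc e) = acost e + 1"
| "acost (Dec e) = acost e + 1"

fun bcost :: "bexp \<Rightarrow> nat" where
  "bcost (Less e f) = acost e + acost f + 1"
| "bcost (Equal e f) = acost e + acost f + 1"
| "bcost (Not b) = bcost b + 1"
| "bcost (And b b') = bcost b + bcost b' + 1"

text \<open>\<^term>\<open>exec c s T s'\<close>: started in \<^term>\<open>s\<close>, the program \<^term>\<open>c\<close> halts in \<^term>\<open>s'\<close> after T steps.\<close>

inductive exec :: "com \<Rightarrow> state \<Rightarrow> nat \<Rightarrow> state \<Rightarrow> bool" where
  Skip: "exec Skip s 1 s"
| Assign: "exec (Assign x e) s (acost e + 1) ((fst s)(x := aval e s), snd s)"
| Put: "exec (Put a i e) s (acost i + acost e + 1)
          (fst s, (snd s)(a := (snd s a)(aval i s := aval e s)))"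
| Seq: "exec c s T s' \<Longrightarrow> exec c' s' T' s'' \<Longrightarrow> exec (Seq c c') s (T + T') s''"
| IfTrue: "bval b s \<Longrightarrow> exec c s T s' \<Longrightarrow> exec (If b c c') s (bcost b + 1 + T) s'"
| IfFalse: "\<not> bval b s \<Longrightarrow> exec c' s T s' \<Longrightarrow> exec (If b c c') s (bcost b + 1 + T) s'"
| WhileFalse: "\<not> bval b s \<Longrightarrow> exec (While b c) s (bcost b + 1) s"
| WhileTrue: "bval b s \<Longrightarrow> exec c s T s' \<Longrightarrow> exec (While b c) s' T' s'' \<Longrightarrow>
    exec (While b c) s (bcost b + 1 + T + T') s''"

inductive_cases SkipE: "exec Skip s T s'"
inductive_cases AssignE: "exec (Assign x e) s T s'"
inductive_cases PutE: "exec (Put a i e) s T s'"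
inductive_cases SeqE: "exec (Seq c c') s T s'"
inductive_cases IfE: "exec (If b c c') s T s'"
inductive_cases WhileE: "exec (While b c) s T s'"

lemma exec_deterministic:
  "exec c s T s' \<Longrightarrow> exec c s T' s'' \<Longrightarrow> T' = T \<and> s'' = s'"
proof (induction arbitrary: T' s'' rule: exec.induct)
  case (Skip s)
  then show ?case by (rule SkipE) simp
next
  case (Assign x e s)
  then show ?case by (rule AssignE) simp
next
  case (Put a i e s)
  then show ?case by (rule PutE) simp
next
  case (Seq c s T s1 c' T2 s2)
  from Seq.prems show ?case by (rule SeqE) (metis Seq.IH)
next
  case (IfTrue b s c T s1 c')
  from IfTrue.prems show ?case by (rule IfE) (use IfTrue.hyps in \<open>auto dest: IfTrue.IH\<close>)
next
  case (IfFalse b s c' T s1 c)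
  from IfFalse.prems show ?case by (rule IfE) (use IfFalse.hyps in \<open>auto dest: IfFalse.IH\<close>)
next
  case (WhileFalse b s c)
  from WhileFalse.prems show ?case by (rule WhileE) (use WhileFalse.hyps in \<open>auto\<close>)
next
  case (WhileTrue b s c T s1 T2 s2)
  from WhileTrue.prems show ?case proof (rule WhileE)
    fix T3 s3 T4
    assume *: "T' = Suc (bcost b + T3 + T4)" "exec c s T3 s3" "exec (While b c) s3 T4 s''"
    from WhileTrue.IH(1)[OF *(2)] have "T3 = T" "s3 = s1" by simp_all
    with WhileTrue.IH(2)[of T4 s''] * show ?thesis by simp
  qed (use WhileTrue.hyps in simp)
qed

text \<open>
  A graph on the vertices 0, ..., n - 1 is given by adjacency lists, in arbitrary order.  They are
  stored consecutively in the array nbr: the neighbours of v are the entries of nbr at the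
  positions off[v], ..., off[v + 1] - 1.
\<close>

definition adjacency_lists :: "nat list list \<Rightarrow> nat set \<Rightarrow> nat set set \<Rightarrow> bool" where
  "adjacency_lists adj V E \<longleftrightarrow>
     V = {..<length adj} \<and>
     (\<forall>v < length adj. distinct (adj ! v) \<and> set (adj ! v) = nbrs E v)"

definition input_state :: "nat list list \<Rightarrow> state" where
  "input_state adj =
     ((\<lambda>x. if x = ''n'' then length adj else 0),
      (\<lambda>a i. if a = ''off'' \<and> i \<le> length adj then length (concat (take i adj))
             else if a = ''nbr'' \<and> i < length (concat adj) then concat adj ! i
             else 0))"

text \<open>
  The output is a list of k edges without repetitions; the i-th edge joins src[i] and dst[i].
\<close>

definition outputs_edges :: "state \<Rightarrow> nat set set \<Rightarrow> bool" where
  "outputs_edges s M \<longleftrightarrow>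
     M = {{snd s ''src'' i, snd s ''dst'' i} | i. i < fst s ''k''} \<and> card M = fst s ''k''"

text \<open>
  On every graph satisfying P, some edge set M satisfying Q can be computed in time linear in the
  number of vertices and edges, by one program for all these graphs.
\<close>

definition linear_time_edge_search ::
  "(nat set \<Rightarrow> nat set set \<Rightarrow> bool) \<Rightarrow> (nat set \<Rightarrow> nat set set \<Rightarrow> nat set set \<Rightarrow> bool) \<Rightarrow> bool" where
  "linear_time_edge_search P Q \<longleftrightarrow>
     (\<exists>prog C. \<forall>adj V E. simple_graph V E \<and> adjacency_lists adj V E \<and> P V E \<longrightarrow>
        (\<exists>T s M. exec prog (input_state adj) T s \<and> T \<le> C * (card V + card E) \<and>
           outputs_edges s M \<and> Q V E M))"

end

theory Submission imports Defs begin

text \<open>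
  Let r be a vertex of degree more than d (a vertex of degree at most d is itself one side of a
  d-cut), and let k = \<Delta> - d, so that (t - 1) k \<le> d + 1.  If every vertex of the ball of radius
  l around r has at most d neighbours outside the ball, let B be this ball.  Otherwise some x at
  distance l from r has at least d + 1 neighbours at distance l + 1.  Were the graph induced by
  these neighbours and x (k - 1)-degenerate, it would contain an independent set of size t, which
  together with x and a shortest path from x to r would induce S_{1^t,l}; so some set B of these
  vertices has minimum degree at least k, and again no vertex of B has more than d neighbours
  outside B.

  Now add to B, as long as possible, vertices with more than d neighbours in B.  As \<Delta> \<le> 2d + 1,
  every addition decreases the number of edges leaving B, which is at most d|B| initially.  The
  process ends with a set of at most (d + 1)|B| < |V| vertices, which is one side of a d-cut.

  This set has bounded size and lies within bounded distance of r, the bounds depending only on d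
  and l.  Starting from vertex 0 it can therefore be found by exhaustive search in constant time.
\<close>

section \<open>Balls and spheres\<close>

primrec ball :: "'a set set \<Rightarrow> 'a \<Rightarrow> nat \<Rightarrow> 'a set" where
  "ball E r 0 = {r}"
| "ball E r (Suc i) = ball E r i \<union> (\<Union>v\<in>ball E r i. nbrs E v)"

definition sphere :: "'a set set \<Rightarrow> 'a \<Rightarrow> nat \<Rightarrow> 'a set" where
  "sphere E r i = ball E r i - (\<Union>m<i. ball E r m)"

lemma nbrs_sym: "u \<in> nbrs E v \<longleftrightarrow> v \<in> nbrs E u"
  by (simp add: nbrs_def insert_commute)

lemma ball_mono: "i \<le> j \<Longrightarrow> ball E r i \<subseteq> ball E r j"
  by (rule lift_Suc_mono_le[of "ball E r"]) auto

lemma nbrs_ball: "v \<in> ball E r i \<Longrightarrow> u \<in> nbrs E v \<Longrightarrow> u \<in> ball E r (Suc i)"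
  by auto

lemma sphere_Suc: "sphere E r (Suc i) = ball E r (Suc i) - ball E r i"
proof -
  have "(\<Union>m<Suc i. ball E r m) = ball E r i"
    using ball_mono[of _ i E r] by (fastforce simp: less_Suc_eq_le)
  then show ?thesis by (simp add: sphere_def)
qed

lemma sphere_disjoint: "u \<in> sphere E r i \<Longrightarrow> u \<in> sphere E r j \<Longrightarrow> i = j"
  by (cases i j rule: linorder_cases) (auto simp: sphere_def)

lemma sphere_adjacent:
  assumes "u \<in> sphere E r i" "v \<in> sphere E r j" "{u, v} \<in> E"
  shows "i \<le> Suc j" "j \<le> Suc i"
proof -
  have "v \<in> ball E r (Suc i)"
    using assms nbrs_ball[of u E r i v] by (auto simp: sphere_def nbrs_def)
  with assms(2) show "j \<le> Suc i" unfolding sphere_def by (meson DiffD2 UN_I lessThan_iff not_le)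
  have "u \<in> ball E r (Suc j)"
    using assms nbrs_ball[of v E r j u] by (auto simp: sphere_def nbrs_def insert_commute)
  with assms(1) show "i \<le> Suc j" unfolding sphere_def by (meson DiffD2 UN_I lessThan_iff not_le)
qed

lemma sphere_predecessor:
  assumes "v \<in> sphere E r (Suc i)"
  obtains u where "u \<in> sphere E r i" "{v, u} \<in> E"
proof -
  from assms obtain u where u: "u \<in> ball E r i" "v \<in> nbrs E u" "v \<notin> ball E r i"
    by (auto simp: sphere_Suc)
  \<comment> \<open>If \<open>u\<close> were already in a smaller ball, its neighbour
    \<open>v\<close> would lie in the ball of radius \<open>i\<close>.\<close>
  have "u \<notin> ball E r m" if "m < i" for m
    using that u nbrs_ball[of u E r m v] ball_mono[of "Suc m" i E r] by auto
  with u show ?thesis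
    by (intro that[of u]) (auto simp: sphere_def nbrs_def insert_commute)
qed

text \<open>Iterating \<open>sphere_predecessor\<close> descends one distance level per step. The
  path is indexed from \<open>x\<close> towards \<open>r\<close>, the order in which it becomes the
  long leg of S_{1^t,l}.\<close>

lemma sphere_geodesic:
  "x \<in> sphere E r i \<Longrightarrow>
    \<exists>p. p 0 = x \<and> (\<forall>m\<le>i. p m \<in> sphere E r (i - m)) \<and> (\<forall>m<i. {p m, p (Suc m)} \<in> E)"
proof (induction i arbitrary: x)
  case 0
  then show ?case by (intro exI[of _ "\<lambda>_. x"]) auto
next
  case (Suc i)
  from Suc.prems obtain u where u: "u \<in> sphere E r i" "{x, u} \<in> E" by (rule sphere_predecessor)
  from Suc.IH[OF u(1)] obtain p where p: "p 0 = u"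
    "\<forall>m\<le>i. p m \<in> sphere E r (i - m)" "\<forall>m<i. {p m, p (Suc m)} \<in> E" by blast
  show ?case
    by (rule exI[of _ "case_nat x p"]) (use p u Suc.prems in \<open>auto split: nat.split\<close>)
qed

locale sgraph =
  fixes V :: "'a set" and E :: "'a set set"
  assumes simple: "simple_graph V E"
begin

lemma finite_V: "finite V"
  using simple by (simp add: simple_graph_def)

lemma edge_in_V: "{u, v} \<in> E \<Longrightarrow> u \<in> V \<and> v \<in> V \<and> u \<noteq> v"
  using simple by (fastforce simp: simple_graph_def doubleton_eq_iff)

lemma nbrs_subset: "nbrs E v \<subseteq> V"
  using edge_in_V by (auto simp: nbrs_def)

lemma finite_nbrs [simp]: "finite (nbrs E v)"
  using nbrs_subset finite_V by (rule finite_subset)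

lemma not_self_nbr [simp]: "v \<notin> nbrs E v"
  using edge_in_V[of v v] by (auto simp: nbrs_def)

lemma card_nbrs_le: "card (nbrs E v) \<le> max_degree V E"
proof (cases "v \<in> V")
  case True
  then show ?thesis
    using finite_V by (auto simp: max_degree_def degree_def intro!: Max_ge)
next
  case False
  then have "nbrs E v = {}" using edge_in_V by (auto simp: nbrs_def)
  then show ?thesis by simp
qed

lemma ball_subset: "r \<in> V \<Longrightarrow> ball E r i \<subseteq> V"
  by (induction i) (use nbrs_subset in auto)

text \<open>A vertex on a sphere of positive radius spends one of its at most \<Delta> edges on a
  predecessor, so at most \<Delta> - 1 lead to the next sphere.\<close>

lemma card_sphere:
  assumes "r \<in> V"
  shows "card (sphere E r (Suc i)) \<le> max_degree V E * (max_degree V E - 1) ^ i"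
proof (induction i)
  case 0
  have "sphere E r (Suc 0) \<subseteq> nbrs E r" by (auto simp: sphere_Suc)
  then have "card (sphere E r (Suc 0)) \<le> card (nbrs E r)" by (intro card_mono) auto
  then show ?case using card_nbrs_le[of r] by simp
next
  case (Suc i)
  let ?D = "max_degree V E"
  let ?S = "sphere E r (Suc i)" and ?S' = "sphere E r (Suc (Suc i))"
  have fin: "finite ?S"
    using ball_subset[OF assms, of "Suc i"] finite_V by (auto simp: sphere_def intro: finite_subset)
  have sub: "?S' \<subseteq> (\<Union>u\<in>?S. nbrs E u \<inter> ?S')"
  proof
    fix v assume v: "v \<in> ?S'"
    then obtain u where "u \<in> ?S" "{v, u} \<in> E" by (rule sphere_predecessor)
    with v show "v \<in> (\<Union>u\<in>?S. nbrs E u \<inter> ?S')" by (auto simp: nbrs_def insert_commute)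
  qed
  have one: "card (nbrs E u \<inter> ?S') \<le> ?D - 1" if u: "u \<in> ?S" for u
  proof -
    obtain w where w: "w \<in> sphere E r i" "{u, w} \<in> E" using u by (rule sphere_predecessor)
    have "w \<notin> ?S'" using sphere_disjoint[OF w(1), of "Suc (Suc i)"] by auto
    then have "nbrs E u \<inter> ?S' \<subseteq> nbrs E u - {w}" by auto
    then have "card (nbrs E u \<inter> ?S') \<le> card (nbrs E u - {w})" by (intro card_mono) auto
    also have "\<dots> = card (nbrs E u) - 1" using w by (simp add: nbrs_def)
    finally show ?thesis using card_nbrs_le[of u] by linarith
  qed
  have "card ?S' \<le> card (\<Union>u\<in>?S. nbrs E u \<inter> ?S')"
    by (rule card_mono[OF _ sub]) (use fin in auto)
  also have "\<dots> \<le> (\<Sum>u\<in>?S. card (nbrs E u \<inter> ?S'))" by (rule card_UN_le[OF fin])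
  also have "\<dots> \<le> card ?S * (?D - 1)"
    using sum_bounded_above[of ?S "\<lambda>u. card (nbrs E u \<inter> ?S')" "?D - 1"] one by simp
  also have "\<dots> \<le> ?D * (?D - 1) ^ i * (?D - 1)" using Suc.IH by (intro mult_right_mono) auto
  finally show ?case by (simp add: mult_ac)
qed

text \<open>The geometric series of the bounds in \<open>card_sphere\<close>, multiplied by
  \<open>m\<close> = \<Delta> - 2 to stay in the naturals. At radius l + 1 it yields the fraction in
  the lower bound on |V|.\<close>

lemma card_ball:
  assumes "r \<in> V" "max_degree V E = m + 2"
  shows "m * card (ball E r i) + 2 \<le> (m + 2) * (m + 1) ^ i"
proof (induction i)
  case (Suc i)
  have "ball E r (Suc i) = ball E r i \<union> sphere E r (Suc i)" by (auto simp: sphere_Suc)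
  then have "card (ball E r (Suc i)) \<le> card (ball E r i) + card (sphere E r (Suc i))"
    by (metis card_Un_le)
  also have "\<dots> \<le> card (ball E r i) + (m + 2) * (m + 1) ^ i"
    using card_sphere[OF assms(1), of i] assms(2) by simp
  finally have "m * card (ball E r (Suc i)) \<le> m * (card (ball E r i) + (m + 2) * (m + 1) ^ i)"
    by (rule mult_left_mono) simp
  with Suc.IH show ?case by (simp add: algebra_simps)
qed simp


section \<open>Small sets with few outside neighbours\<close>

text \<open>A set in which every non-empty subset has a vertex of small degree is degenerate, so a
  greedy choice yields a large independent set.\<close>

lemma degenerate_independent:
  assumes "finite W" "k \<ge> 1" "card W + k > t * k"
    and "\<And>B. B \<subseteq> W \<Longrightarrow> B \<noteq> {} \<Longrightarrow> \<exists>b\<in>B. card (nbrs E b \<inter> B) < k"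
  shows "\<exists>I\<subseteq>W. card I = t \<and> (\<forall>u\<in>I. \<forall>v\<in>I. {u, v} \<notin> E)"
  using assms
proof (induction t arbitrary: W)
  case 0
  then show ?case by (intro exI[of _ "{}"]) auto
next
  case (Suc t)
  have "W \<noteq> {}" using Suc.prems by auto
  with Suc.prems(4)[of W] obtain b where b: "b \<in> W" "card (nbrs E b \<inter> W) < k" by auto
  \<comment> \<open>Deleting \<open>b\<close> and its fewer than \<open>k\<close> neighbours costs
    at most \<open>k\<close> vertices, which the drop from \<open>Suc t\<close> to \<open>t\<close>
    pays for.\<close>
  define W' where "W' = W - insert b (nbrs E b \<inter> W)"
  have "card W' = card W - card (insert b (nbrs E b \<inter> W))"
    unfolding W'_def using b Suc.prems by (intro card_Diff_subset) auto
  moreover have "card (insert b (nbrs E b \<inter> W)) \<le> k" using b by simp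
  ultimately have "card W' + k > t * k" using Suc.prems by auto
  moreover have "W' \<subseteq> W" by (auto simp: W'_def)
  ultimately have "\<exists>I\<subseteq>W'. card I = t \<and> (\<forall>u\<in>I. \<forall>v\<in>I. {u, v} \<notin> E)"
    using Suc.prems by (intro Suc.IH) (auto intro: finite_subset)
  then obtain I where I: "I \<subseteq> W'" "card I = t" "\<forall>u\<in>I. \<forall>v\<in>I. {u, v} \<notin> E" by blast
  have "finite I" using I \<open>W' \<subseteq> W\<close> Suc.prems(1) by (meson finite_subset)
  moreover have "b \<notin> I" using I by (auto simp: W'_def)
  moreover have "{b, u} \<notin> E \<and> {u, b} \<notin> E" if "u \<in> I" for u
    using that I by (auto simp: W'_def nbrs_def insert_commute)
  moreover have "{b, b} \<notin> E" using edge_in_V[of b b] by auto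
  ultimately show ?case
    using I b \<open>W' \<subseteq> W\<close> by (intro exI[of _ "insert b I"]) auto
qed

text \<open>Pairs with i < j suffice because adjacency is symmetric and loop-free in both
  graphs.\<close>

lemma not_free_if_embedding:
  assumes sub: "\<And>i. i \<le> t + l \<Longrightarrow> g i \<in> V"
    and inj: "\<And>i j. i < j \<Longrightarrow> j \<le> t + l \<Longrightarrow> g i \<noteq> g j"
    and edge: "\<And>i j. i < j \<Longrightarrow> j \<le> t + l \<Longrightarrow>
      {g i, g j} \<in> E \<longleftrightarrow> i = 0 \<and> j \<le> t + 1 \<or> t + 1 \<le> i \<and> j = i + 1"
  shows "\<not> is_free (S_verts t l) (S_edges t l) V E"
proof -
  have injg: "inj_on g (S_verts t l)"
    by (rule linorder_inj_onI) (use inj in \<open>auto simp: S_verts_def\<close>)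
  have S: "{i, j} \<in> S_edges t l \<longleftrightarrow> i = 0 \<and> j \<le> t + 1 \<or> t + 1 \<le> i \<and> j = i + 1"
    if "i < j" "j \<le> t + l" for i j
    using that by (auto simp: S_edges_def doubleton_eq_iff)
  have S0: "{i} \<notin> S_edges t l" for i
    by (auto simp: S_edges_def doubleton_eq_iff)
  have E0: "{v} \<notin> E" for v
    using edge_in_V[of v v] by auto
  have eq: "{g i, g j} \<in> E \<longleftrightarrow> {i, j} \<in> S_edges t l" if "i \<le> t + l" "j \<le> t + l" for i j
    using that S[of i j] S[of j i] S0[of i] E0[of "g i"] edge[of i j] edge[of j i]
    by (cases i j rule: linorder_cases) (auto simp: insert_commute)
  \<comment> \<open>\<open>graph_iso\<close> maps the induced subgraph to S_{1^t,l}, hence the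
    inverse of the embedding \<open>g\<close>.\<close>
  define f where "f = the_inv_into (S_verts t l) g"
  have f: "f (g i) = i" if "i \<le> t + l" for i
    unfolding f_def using that by (intro the_inv_into_f_f injg) (simp add: S_verts_def)
  have "bij_betw f (g ` S_verts t l) (S_verts t l)"
    unfolding f_def using injg by (intro bij_betw_the_inv_into) (simp add: bij_betw_def)
  moreover have "{g i, g j} \<in> induced_edges E (g ` S_verts t l) \<longleftrightarrow> {f (g i), f (g j)} \<in> S_edges t l"
    if "i \<in> S_verts t l" "j \<in> S_verts t l" for i j
    using that eq f by (simp add: induced_edges_def S_verts_def)
  ultimately have "graph_iso (g ` S_verts t l) (induced_edges E (g ` S_verts t l)) (S_verts t l) (S_edges t l)"
    unfolding graph_iso_def by blast
  moreover have "g ` S_verts t l \<subseteq> V" using sub by (auto simp: S_verts_def)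
  ultimately show ?thesis unfolding is_free_def by blast
qed

text \<open>Distances from \<open>r\<close> exclude unwanted edges, since the ends of an edge differ
  in distance by at most 1. The leaves in \<open>I\<close> are at distance l + 1, the path vertices
  after \<open>x\<close> at distance at most l - 1, and nonconsecutive path vertices differ by at
  least 2. Among the leaves, independence is used.\<close>

lemma not_free_if_star_and_geodesic:
  assumes r: "r \<in> V" and x: "x \<in> sphere E r l"
    and I: "I \<subseteq> nbrs E x \<inter> sphere E r (Suc l)" "card I = t" "\<forall>u\<in>I. \<forall>v\<in>I. {u, v} \<notin> E"
  shows "\<not> is_free (S_verts t l) (S_edges t l) V E"
proof -
  from sphere_geodesic[OF x] obtain p where p: "p 0 = x"
    "\<And>m. m \<le> l \<Longrightarrow> p m \<in> sphere E r (l - m)" "\<And>m. m < l \<Longrightarrow> {p m, p (Suc m)} \<in> E" by blast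
  have "finite I" using I(1) finite_subset[of I "nbrs E x"] by auto
  then obtain y where y: "bij_betw y {1..t} I"
    using I(2) ex_bij_betw_nat_finite_1[of I] by auto
  have yI: "y i \<in> I" if "1 \<le> i" "i \<le> t" for i
    using that y by (auto simp: bij_betw_def)
  have yinj: "y i \<noteq> y j" if "1 \<le> i" "i < j" "j \<le> t" for i j
    using that inj_onD[OF bij_betw_imp_inj_on[OF y], of i j] by auto
  \<comment> \<open>The centre goes to \<open>x\<close>, the numbers 1 to t to the leaves, and
    \<open>t + m\<close> to \<open>p m\<close>; \<open>h\<close> records the distance of the image
    from \<open>r\<close>.\<close>
  define g where "g n = (if n = 0 then x else if n \<le> t then y n else p (n - t))" for n
  define h where "h n = (if n = 0 then l else if n \<le> t then Suc l else l - (n - t))" for n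
  have gh: "g n \<in> sphere E r (h n)" if "n \<le> t + l" for n
  proof -
    consider "n = 0" | "1 \<le> n" "n \<le> t" | "t < n" by linarith
    then show ?thesis
    proof cases
      case 2
      then show ?thesis using yI[of n] I(1) by (auto simp: g_def h_def)
    qed (use that x p(2)[of "n - t"] in \<open>simp_all add: g_def h_def\<close>)
  qed
  have V: "sphere E r i \<subseteq> V" for i
    using ball_subset[OF r, of i] by (auto simp: sphere_def)
  have close: "h i \<le> Suc (h j) \<and> h j \<le> Suc (h i)"
    if "{g i, g j} \<in> E" "i \<le> t + l" "j \<le> t + l" for i j
    using sphere_adjacent[OF gh[of i] gh[of j]] that by auto
  show ?thesis
  proof (rule not_free_if_embedding[of t l g])
    show "g i \<in> V" if "i \<le> t + l" for i using gh[OF that] V[of "h i"] by blast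
  next
    fix i j assume ij: "i < j" "j \<le> t + l"
    show "g i \<noteq> g j"
    proof
      assume "g i = g j"
      then have "h i = h j" using sphere_disjoint[of "g i" E r "h i" "h j"] gh[of i] gh[of j] ij by simp
      then have "1 \<le> i \<and> j \<le> t" using ij by (auto simp: h_def split: if_splits)
      with yinj[of i j] ij \<open>g i = g j\<close> show False by (auto simp: g_def)
    qed
    show "{g i, g j} \<in> E \<longleftrightarrow> i = 0 \<and> j \<le> t + 1 \<or> t + 1 \<le> i \<and> j = i + 1"
    proof
      assume e: "{g i, g j} \<in> E"
      with close[of i j] ij have c: "h i \<le> Suc (h j)" "h j \<le> Suc (h i)" by auto
      have "\<not> (1 \<le> i \<and> j \<le> t)"
        using e ij I(3) yI[of i] yI[of j] by (auto simp: g_def)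
      with c ij show "i = 0 \<and> j \<le> t + 1 \<or> t + 1 \<le> i \<and> j = i + 1"
        by (auto simp: h_def split: if_splits)
    next
      assume "i = 0 \<and> j \<le> t + 1 \<or> t + 1 \<le> i \<and> j = i + 1"
      then consider "i = 0" "j \<le> t" | "i = 0" "j = t + 1" | "t + 1 \<le> i" "j = i + 1" by linarith
      then show "{g i, g j} \<in> E"
      proof cases
        case 1
        then show ?thesis using ij yI[of j] I(1) by (auto simp: g_def nbrs_def)
      next
        case 2
        then show ?thesis using ij p(1) p(3)[of 0] by (auto simp: g_def)
      next
        case 3
        then show ?thesis using ij p(3)[of "i - t"] by (auto simp: g_def Suc_diff_le)
      qed
    qed
  qed
qed

text \<open>The degree hypothesis is the bound on \<Delta> cleared of its denominator. Radius l + 1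
  covers both cases: the ball of radius l itself, and a set that may reach one sphere
  further.\<close>

lemma few_outside_nbrs_in_ball:
  assumes free: "is_free (S_verts t l) (S_edges t l) V E" and r: "r \<in> V"
    and tl: "t \<ge> 2" and deg: "(t - 1) * max_degree V E \<le> t * d + 1"
  obtains B where "B \<subseteq> ball E r (Suc l)" "B \<noteq> {}" "\<forall>b\<in>B. card (nbrs E b - B) \<le> d"
proof (cases "\<forall>b\<in>ball E r l. card (nbrs E b - ball E r l) \<le> d")
  case True
  have "r \<in> ball E r l" using ball_mono[of 0 l E r] by auto
  with True show ?thesis by (intro that[of "ball E r l"]) auto
next
  case False
  then obtain x where x: "x \<in> ball E r l" "card (nbrs E x - ball E r l) > d" by auto
  define N where "N = nbrs E x - ball E r l"
  define k where "k = max_degree V E - d"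
  have NS: "N \<subseteq> sphere E r (Suc l)"
    using x by (auto simp: N_def sphere_Suc)
  \<comment> \<open>A vertex closer to \<open>r\<close> than \<open>l\<close> has all its neighbours
    in the ball of radius \<open>l\<close>.\<close>
  have "x \<notin> ball E r m" if "m < l" for m
  proof
    assume "x \<in> ball E r m"
    then have "nbrs E x \<subseteq> ball E r l"
      using that nbrs_ball[of x E r m] ball_mono[of "Suc m" l E r] by auto
    then have "nbrs E x - ball E r l = {}" by auto
    with x show False by (metis card.empty not_less_zero)
  qed
  with x have xs: "x \<in> sphere E r l" by (auto simp: sphere_def)
  have "card N \<le> card (nbrs E x)" unfolding N_def by (intro card_mono) auto
  then have dD: "d < max_degree V E" using card_nbrs_le[of x] x by (simp add: N_def)
  then have k1: "k \<ge> 1" by (simp add: k_def)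
  obtain t' where t': "t = Suc t'" using tl by (cases t) auto
  \<comment> \<open>Substituting \<Delta> = d + k into the degree bound gives (t - 1)k \<le> d + 1,
    which is less than the size of \<open>insert x N\<close>, at least d + 2.\<close>
  have "t' * k + t' * d \<le> t' * d + d + 1"
    using deg dD t' by (simp add: k_def add_mult_distrib2[symmetric])
  then have "t * k \<le> d + 1 + k" using t' by simp
  moreover have "card (insert x N) = Suc (card N)" by (subst card_insert_disjoint) (auto simp: N_def)
  ultimately have big: "card (insert x N) + k > t * k" using x by (simp add: N_def)
  have finN: "finite (insert x N)" by (auto simp: N_def)
  have "\<exists>B\<subseteq>insert x N. B \<noteq> {} \<and> (\<forall>b\<in>B. k \<le> card (nbrs E b \<inter> B))"
  proof (rule ccontr)
    assume "\<not> ?thesis"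
    then have "\<exists>b\<in>B. card (nbrs E b \<inter> B) < k" if "B \<subseteq> insert x N" "B \<noteq> {}" for B
      using that by (meson not_le)
    from degenerate_independent[OF finN k1 big this]
    obtain I where I: "I \<subseteq> insert x N" "card I = t" "\<forall>u\<in>I. \<forall>v\<in>I. {u, v} \<notin> E" by blast
    \<comment> \<open>All of \<open>N\<close> is adjacent to \<open>x\<close>, so an independent set
      containing \<open>x\<close> has one element, fewer than \<open>t\<close>.\<close>
    have "x \<notin> I"
    proof
      assume xI: "x \<in> I"
      have "I \<subseteq> {x}" using I xI by (auto simp: N_def nbrs_def)
      then have "card I \<le> 1" using card_mono[of "{x}" I] by simp
      with I(2) tl show False by simp
    qed
    then have "I \<subseteq> nbrs E x \<inter> sphere E r (Suc l)" using I(1) NS by (auto simp: N_def)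
    from not_free_if_star_and_geodesic[OF r xs this I(2,3)] free show False by simp
  qed
  then obtain B where B: "B \<subseteq> insert x N" "B \<noteq> {}" "\<forall>b\<in>B. k \<le> card (nbrs E b \<inter> B)" by blast
  \<comment> \<open>With at least \<Delta> - d neighbours inside \<open>B\<close>, at most d remain
    outside.\<close>
  have "card (nbrs E b - B) \<le> d" if "b \<in> B" for b
  proof -
    have "card (nbrs E b - B) = card (nbrs E b) - card (nbrs E b \<inter> B)"
      by (simp add: card_Diff_subset_Int)
    with B(3) that card_nbrs_le[of b] show ?thesis by (auto simp: k_def)
  qed
  moreover have "B \<subseteq> ball E r (Suc l)"
    using B(1) x by (auto simp: N_def)
  ultimately show ?thesis using B by (intro that[of B]) auto
qed


section \<open>Closing the set\<close>

text \<open>Adding a vertex with more than d neighbours inside decreases the number of edges leaving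
  the set, which bounds the number of additions.\<close>

lemma cut_closure:
  assumes deg: "max_degree V E \<le> 2 * d + 1" and r: "r \<in> V"
    and "B \<subseteq> ball E r i" "\<forall>b\<in>B. card (nbrs E b - B) \<le> d"
    and "(\<Sum>b\<in>B. card (nbrs E b - B)) \<le> e"
  shows "\<exists>B'. B \<subseteq> B' \<and> B' \<subseteq> ball E r (i + e) \<and> card B' \<le> card B + e \<and>
    (\<forall>b\<in>B'. card (nbrs E b - B') \<le> d) \<and> (\<forall>u\<in>V - B'. card (nbrs E u \<inter> B') \<le> d)"
  using assms(3-)
proof (induction e arbitrary: B i rule: less_induct)
  case (less e)
  show ?case
  proof (cases "\<forall>u\<in>V - B. card (nbrs E u \<inter> B) \<le> d")
    case True
    then show ?thesis
      using less.prems ball_mono[of i "i + e" E r] by (intro exI[of _ B]) auto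
  next
    case False
    then obtain u where u: "u \<in> V" "u \<notin> B" "card (nbrs E u \<inter> B) > d" by auto
    define B1 where "B1 = insert u B"
    have finB: "finite B"
      using less.prems(1) ball_subset[OF r] finite_V by (meson finite_subset)
    have "card (nbrs E u - B) = card (nbrs E u) - card (nbrs E u \<inter> B)"
      by (simp add: card_Diff_subset_Int)
    \<comment> \<open>Of at most 2d + 1 neighbours, at least d + 1 lie in \<open>B\<close>.\<close>
    then have uout: "card (nbrs E u - B) \<le> d" using u card_nbrs_le[of u] deg by linarith
    have uB1: "nbrs E u - B1 = nbrs E u - B" by (auto simp: B1_def)
    have bB1: "card (nbrs E b - B1) + (if b \<in> nbrs E u then 1 else 0) = card (nbrs E b - B)"
      if "b \<in> B" for b
    proof (cases "b \<in> nbrs E u")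
      case True
      then have "nbrs E b - B = insert u (nbrs E b - B1)"
        using u(2) nbrs_sym[of u E b] by (auto simp: B1_def)
      moreover have "u \<notin> nbrs E b - B1" by (simp add: B1_def)
      ultimately show ?thesis using True by simp
    next
      case False
      then have "nbrs E b - B = nbrs E b - B1"
        using nbrs_sym[of u E b] by (auto simp: B1_def)
      then show ?thesis using False by simp
    qed
    have good: "\<forall>b\<in>B1. card (nbrs E b - B1) \<le> d"
    proof
      fix b assume "b \<in> B1"
      then show "card (nbrs E b - B1) \<le> d"
        using bB1[of b] less.prems(2) uout uB1 by (cases "b = u") (force simp: B1_def)+
    qed
    obtain b where b: "b \<in> B" "b \<in> nbrs E u"
      using u(3) by (metis IntE card.empty ex_in_conv not_less_zero)
    then have "u \<in> ball E r (Suc i)"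
      using less.prems(1) nbrs_ball[of b E r i u] nbrs_sym[of u E b] by auto
    then have sub: "B1 \<subseteq> ball E r (Suc i)" using less.prems(1) by (auto simp: B1_def)
    \<comment> \<open>Moving \<open>u\<close> inside removes its more than d edges to
      \<open>B\<close> from the boundary and adds at most d others, so the boundary shrinks by at
      least one.\<close>
    have "(\<Sum>b\<in>B. card (nbrs E b - B)) =
        (\<Sum>b\<in>B. card (nbrs E b - B1)) + (\<Sum>b\<in>B. if b \<in> nbrs E u then 1 else 0)"
      using bB1 by (simp add: sum.distrib[symmetric])
    also have "(\<Sum>b\<in>B. if b \<in> nbrs E u then 1 else 0) = card (nbrs E u \<inter> B)"
      using finB by (simp add: sum.If_cases Int_commute)
    finally have "(\<Sum>b\<in>B. card (nbrs E b - B1)) + card (nbrs E u \<inter> B) \<le> e"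
      using less.prems(3) by simp
    moreover have "(\<Sum>b\<in>B1. card (nbrs E b - B1)) =
        card (nbrs E u - B1) + (\<Sum>b\<in>B. card (nbrs E b - B1))"
      using u(2) finB by (simp add: B1_def)
    ultimately have e: "e \<ge> 1" "(\<Sum>b\<in>B1. card (nbrs E b - B1)) \<le> e - 1"
      using u(3) uout uB1 by auto
    from less.IH[OF _ sub good e(2)] e(1) obtain B' where
      "B1 \<subseteq> B'" "B' \<subseteq> ball E r (Suc i + (e - 1))" "card B' \<le> card B1 + (e - 1)"
      "\<forall>b\<in>B'. card (nbrs E b - B') \<le> d" "\<forall>u\<in>V - B'. card (nbrs E u \<inter> B') \<le> d" by auto
    moreover have "card B1 = Suc (card B)" using finB u(2) by (simp add: B1_def)
    ultimately show ?thesis using e(1) by (intro exI[of _ B']) (auto simp: B1_def)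
  qed
qed

end

section \<open>Sides of d-cuts and their existence near a prescribed vertex\<close>

definition cut_side :: "nat \<Rightarrow> 'a set \<Rightarrow> 'a set set \<Rightarrow> 'a set \<Rightarrow> bool" where
  "cut_side d V E B \<longleftrightarrow> B \<subseteq> V \<and> B \<noteq> {} \<and> card B < card V \<and>
     (\<forall>b\<in>B. card (nbrs E b - B) \<le> d) \<and> (\<forall>u\<in>V - B. card (nbrs E u \<inter> B) \<le> d)"

text \<open>The other side is the complement \<open>V - B\<close>, nonempty because
  \<open>card B < card V\<close>; this form of properness can be tested against the stored number of
  vertices.\<close>

lemma d_cut_if_cut_side:
  assumes "simple_graph V E" "cut_side d V E B"
  shows "d_cut d V E {e \<in> E. \<exists>b\<in>B. \<exists>u\<in>V - B. e = {b, u}}"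
proof -
  interpret sgraph V E by standard fact
  have "nbrs E b \<inter> (V - B) = nbrs E b - B" for b
    using nbrs_subset[of b] by auto
  then show ?thesis
    using assms(2) unfolding d_cut_def cut_side_def
    by (intro conjI exI[of _ B] exI[of _ "V - B"]) auto
qed

text \<open>The real bound equals d + (d + 1)/(t - 1), which is largest at t = 2, where it is 2d +
  1.\<close>

lemma admissible_max_degree:
  assumes "admissible d t l V E" "d \<ge> 2" "t \<ge> 2"
  shows "max_degree V E \<ge> 2" "max_degree V E \<le> 2 * d + 1"
    "max_degree V E > 2 \<Longrightarrow> (t - 1) * max_degree V E \<le> t * d + 1"
proof -
  define D where "D = max_degree V E"
  have adm: "D = 2 \<or> 3 \<le> D \<and> real D \<le> real t / (real t - 1) * real d + 1 / (real t - 1)"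
    using assms(1) by (auto simp: admissible_def Let_def D_def)
  have *: "(t - 1) * D \<le> t * d + 1" if "D > 2"
  proof -
    have "real D \<le> (real t * real d + 1) / (real t - 1)"
      using adm that by (auto simp: add_divide_distrib)
    then have "(real t - 1) * real D \<le> real t * real d + 1"
      using assms(3) by (simp add: field_simps)
    then have "real ((t - 1) * D) \<le> real (t * d + 1)"
      using assms(3) by simp
    then show ?thesis by (simp only: of_nat_le_iff)
  qed
  then show "max_degree V E > 2 \<Longrightarrow> (t - 1) * max_degree V E \<le> t * d + 1" by (simp add: D_def)
  show "max_degree V E \<ge> 2" using adm by (auto simp: D_def)
  show "max_degree V E \<le> 2 * d + 1"
  proof (cases "D > 2")
    case True
    obtain t' where t': "t = t' + 2" using assms(3) by (metis add.commute le_iff_add)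
    have "t' * D + D \<le> t' * d + (2 * d + 1)" using *[OF True] t' by simp
    \<comment> \<open>Here \<open>t'\<close> is t - 2. If d \<le> D, subtract
      \<open>t' * d \<le> t' * D\<close>; otherwise D < d.\<close>
    then have "D \<le> 2 * d + 1"
      using mult_le_mono2[of d D t'] by (cases "d \<le> D") linarith+
    then show ?thesis by (simp add: D_def)
  qed (use assms(2) in \<open>simp add: D_def\<close>)
qed

text \<open>The bounds come from a starting set of at most (2d + 1)^(l + 2) vertices, to which the
  closure adds at most d times as many, each enlarging the radius by at most one. They depend on d
  and l alone, and \<open>r\<close> is arbitrary, so a search may start anywhere.\<close>

lemma admissible_cut_side:
  assumes adm: "admissible d t l V E" and d: "d \<ge> 2" and t: "t \<ge> 2" and r: "r \<in> V"
  obtains B where "cut_side d V E B"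
    "B \<subseteq> ball E r (Suc l + d * (2 * d + 1) ^ (l + 2))" "card B \<le> (d + 1) * (2 * d + 1) ^ (l + 2)"
proof -
  interpret sgraph V E by standard (use adm in \<open>simp add: admissible_def\<close>)
  define D where "D = max_degree V E"
  note D = admissible_max_degree[OF adm d t, folded D_def]
  show ?thesis
  proof (cases "card (nbrs E r) \<le> d")
    case True
    \<comment> \<open>A vertex of degree at least 2 shows that \<open>{r}\<close> is a proper subset
      of \<open>V\<close>.\<close>
    have "\<exists>v\<in>V. card (nbrs E v) = D"
    proof -
      have "D \<in> insert 0 (Defs.degree E ` V)"
        unfolding D_def max_degree_def using finite_V by (intro Max_in) auto
      with D(1) show ?thesis by (auto simp: Defs.degree_def)
    qed
    then obtain v where v: "v \<in> V" "card (nbrs E v) \<ge> 2" using D(1) by auto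
    have "card (nbrs E v) \<le> card V" using nbrs_subset finite_V by (intro card_mono) auto
    moreover have "card (nbrs E u \<inter> {r}) \<le> d" for u
      using card_mono[of "{r}" "nbrs E u \<inter> {r}"] d by auto
    moreover have "nbrs E r - {r} = nbrs E r" by auto
    ultimately have "cut_side d V E {r}"
      using True v r by (auto simp: cut_side_def)
    moreover have "{r} \<subseteq> ball E r (Suc l + d * (2 * d + 1) ^ (l + 2))"
      using ball_mono[of 0 _ E r] by (metis ball.simps(1) le0)
    moreover have "card {r} \<le> (d + 1) * (2 * d + 1) ^ (l + 2)"
      using mult_le_mono[of 1 "d + 1" 1 "(2 * d + 1) ^ (l + 2)"] by (simp del: power_Suc)
    ultimately show ?thesis by (rule that)
  next
    case False
    \<comment> \<open>Since d \<ge> 2, the case \<Delta> = 2 is settled by the single vertex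
      \<open>r\<close>; from here on the bounds on \<Delta> and |V| are available.\<close>
    then have D2: "D > 2" using card_nbrs_le[of r] d by (simp add: D_def)
    define m where "m = D - 2"
    have m: "D = m + 2" "m \<ge> 1" using D2 by (auto simp: m_def)
    from few_outside_nbrs_in_ball[OF _ r t D(3)[OF D2, unfolded D_def]] adm
    obtain B where B: "B \<subseteq> ball E r (Suc l)" "B \<noteq> {}" "\<forall>b\<in>B. card (nbrs E b - B) \<le> d"
      by (auto simp: admissible_def)
    have fin: "finite (ball E r i)" for i using ball_subset[OF r] finite_V by (rule finite_subset)
    have cb: "card B \<le> card (ball E r (Suc l))" using B fin by (intro card_mono) auto
    have mb: "m * card (ball E r (Suc l)) + 2 \<le> D * (D - 1) ^ Suc l"
      using card_ball[OF r, of m "Suc l"] m by (simp add: D_def)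
    \<comment> \<open>A crude bound free of \<Delta> and |V|, for the search; the sharper
      \<open>mb\<close> is kept for the comparison with |V|.\<close>
    have "1 * card (ball E r (Suc l)) \<le> m * card (ball E r (Suc l))"
      using m by (intro mult_right_mono) auto
    also have "\<dots> \<le> D * (D - 1) ^ Suc l" using mb by simp
    also have "\<dots> \<le> (2 * d + 1) * (2 * d + 1) ^ Suc l"
      using D(2) by (intro mult_mono power_mono) auto
    finally have cK: "card B \<le> (2 * d + 1) ^ (l + 2)" using cb by (simp add: mult_ac)
    have sum: "(\<Sum>b\<in>B. card (nbrs E b - B)) \<le> d * card B"
      using sum_bounded_above[of B "\<lambda>b. card (nbrs E b - B)" d] B(3) by (simp add: mult.commute)
    from cut_closure[OF D(2)[unfolded D_def] r B(1,3) sum] obtain B' where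
      B': "B \<subseteq> B'" "B' \<subseteq> ball E r (Suc l + d * card B)" "card B' \<le> card B + d * card B"
      "\<forall>b\<in>B'. card (nbrs E b - B') \<le> d" "\<forall>u\<in>V - B'. card (nbrs E u \<inter> B') \<le> d" by blast
    have "real (card V) > (real d + 1) * ((real D * (real D - 1) ^ (l + 1) - 2) / (real D - 2))"
      using adm D2 by (auto simp: admissible_def Let_def D_def)
    moreover have "real (card B) \<le> (real D * (real D - 1) ^ (l + 1) - 2) / (real D - 2)"
    proof -
      have "m * card B + 2 \<le> D * (D - 1) ^ (l + 1)"
        using mb mult_le_mono2[OF cb, of m] unfolding Suc_eq_plus1 by linarith
      then have "real (m * card B + 2) \<le> real (D * (D - 1) ^ (l + 1))" by (simp only: of_nat_le_iff)
      then show ?thesis using m by (simp add: field_simps)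
    qed
    then have "(real d + 1) * real (card B) \<le> (real d + 1) * ((real D * (real D - 1) ^ (l + 1) - 2) / (real D - 2))"
      by (rule mult_left_mono) simp
    ultimately have "real ((d + 1) * card B) < real (card V)" by (simp add: algebra_simps)
    then have "(d + 1) * card B < card V" by (simp only: of_nat_less_iff)
    moreover have "B' \<subseteq> V" using B'(2) ball_subset[OF r] by (rule subset_trans)
    ultimately have "cut_side d V E B'"
      using B' B(2) by (auto simp: cut_side_def)
    moreover have "B' \<subseteq> ball E r (Suc l + d * (2 * d + 1) ^ (l + 2))"
      using B'(2) ball_mono[of "Suc l + d * card B" "Suc l + d * (2 * d + 1) ^ (l + 2)" E r] cK by (simp del: ball.simps)
    moreover have "card B' \<le> (d + 1) * (2 * d + 1) ^ (l + 2)"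
    proof -
      have "card B' \<le> (d + 1) * card B" using B'(3) by simp
      also have "\<dots> \<le> (d + 1) * (2 * d + 1) ^ (l + 2)" using cK by (rule mult_le_mono2)
      finally show ?thesis .
    qed
    ultimately show ?thesis by (rule that)
  qed
qed


section \<open>Loop-free programs\<close>

fun loop_free :: "com \<Rightarrow> bool" where
  "loop_free (Seq c c') \<longleftrightarrow> loop_free c \<and> loop_free c'"
| "loop_free (If b c c') \<longleftrightarrow> loop_free c \<and> loop_free c'"
| "loop_free (While b c) \<longleftrightarrow> False"
| "loop_free _ \<longleftrightarrow> True"

fun max_time :: "com \<Rightarrow> nat" where
  "max_time Skip = 1"
| "max_time (Assign x e) = acost e + 1"
| "max_time (Put a i e) = acost i + acost e + 1"
| "max_time (Seq c c') = max_time c + max_time c'"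
| "max_time (If b c c') = bcost b + 1 + max (max_time c) (max_time c')"
| "max_time (While b c) = 0"

text \<open>Without loops each command is executed at most once, so the time bound is the same on
  all inputs. The value 0 for \<open>While\<close> is a dummy excluded by
  \<open>loop_free\<close>.\<close>

lemma exec_max_time: "exec c s T s' \<Longrightarrow> loop_free c \<Longrightarrow> T \<le> max_time c"
  by (induction rule: exec.induct) auto

fun all_of :: "bexp list \<Rightarrow> bexp" where
  "all_of [] = Equal (Const 0) (Const 0)"
| "all_of (b # bs) = And b (all_of bs)"

lemma bval_all_of [simp]: "bval (all_of bs) s \<longleftrightarrow> (\<forall>b\<in>set bs. bval b s)"
  by (induction bs) auto

text \<open>Tests cannot update a counter, so counting is unfolded into Boolean structure. The last
  equation says: if \<open>b\<close> holds, at most \<open>n\<close> of the rest, else at most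
  \<open>Suc n\<close>.\<close>

fun at_most :: "nat \<Rightarrow> bexp list \<Rightarrow> bexp" where
  "at_most n [] = all_of []"
| "at_most 0 (b # bs) = And (bexp.Not b) (at_most 0 bs)"
| "at_most (Suc n) (b # bs) =
     And (bexp.Not (And b (bexp.Not (at_most n bs))))
         (bexp.Not (And (bexp.Not b) (bexp.Not (at_most (Suc n) bs))))"

lemma bval_at_most [simp]: "bval (at_most n bs) s \<longleftrightarrow> length (filter (\<lambda>b. bval b s) bs) \<le> n"
  by (induction n bs rule: at_most.induct) auto


section \<open>Local search from vertex 0\<close>

text \<open>A vertex is addressed by the list of choices made on a walk from vertex 0, last choice first:
  the address j # p denotes the j-th neighbour of the vertex with address p.  The expression
  for it is meaningful only if the test \<open>valid\<close> succeeds.\<close>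

primrec vertex :: "nat list \<Rightarrow> aexp" where
  "vertex [] = Const 0"
| "vertex (j # p) = Get ''nbr'' ((Inc ^^ j) (Get ''off'' (vertex p)))"

primrec valid :: "nat list \<Rightarrow> bexp" where
  "valid [] = all_of []"
| "valid (j # p) = And (valid p)
     (Less ((Inc ^^ j) (Get ''off'' (vertex p))) (Get ''off'' (Inc (vertex p))))"

definition differs :: "nat list list \<Rightarrow> nat list \<Rightarrow> bexp" where
  "differs A p = all_of (map (\<lambda>q. bexp.Not (Equal (vertex p) (vertex q))) A)"

definition outside :: "nat list list \<Rightarrow> nat list \<Rightarrow> bexp" where
  "outside A p = And (valid p) (differs A p)"

definition inside :: "nat list list \<Rightarrow> nat list \<Rightarrow> bexp" where
  "inside A p = And (valid p) (bexp.Not (differs A p))"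

primrec distinct_vertices :: "nat list list \<Rightarrow> bexp" where
  "distinct_vertices [] = all_of []"
| "distinct_vertices (p # A) = And (differs A p) (distinct_vertices A)"

text \<open>\<open>Not (And a (Not b))\<close> encodes an implication. The range
  \<open>[0..<D]\<close> covers all choices of a neighbour; those beyond the end of an adjacency
  list are rejected by \<open>outside\<close> and \<open>inside\<close>.\<close>

definition cut_test :: "nat \<Rightarrow> nat \<Rightarrow> nat list list \<Rightarrow> bexp" where
  "cut_test d D A = all_of
     (map valid A @
      [distinct_vertices A, Less (Const (length A)) (Var ''n'')] @
      map (\<lambda>p. at_most d (map (\<lambda>j. outside A (j # p)) [0..<D])) A @
      concat (map (\<lambda>p. map (\<lambda>j. bexp.Not (And (outside A (j # p))
        (bexp.Not (at_most d (map (\<lambda>i. inside A (i # j # p)) [0..<D]))))) [0..<D]) A))"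

text \<open>For \<open>q\<close> = \<open>j # p\<close> with \<open>p\<close> in \<open>A\<close>,
  \<open>tl q\<close> addresses the end of the edge inside the cut side and \<open>q\<close> the end
  outside.\<close>

primrec emit :: "nat list list \<Rightarrow> nat list list \<Rightarrow> com" where
  "emit A [] = Skip"
| "emit A (q # qs) = Seq
     (com.If (outside A q)
        (Seq (Put ''src'' (Var ''k'') (vertex (tl q)))
          (Seq (Put ''dst'' (Var ''k'') (vertex q)) (Assign ''k'' (Inc (Var ''k'')))))
        Skip)
     (emit A qs)"

definition emit_cut :: "nat \<Rightarrow> nat list list \<Rightarrow> com" where
  "emit_cut D A = emit A (concat (map (\<lambda>p. map (\<lambda>j. j # p) [0..<D]) A))"

primrec search :: "nat \<Rightarrow> nat \<Rightarrow> nat list list list \<Rightarrow> com" where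
  "search d D [] = Skip"
| "search d D (A # As) = com.If (cut_test d D A) (emit_cut D A) (search d D As)"

lemma loop_free_emit [simp]: "loop_free (emit A qs)"
  by (induction qs) auto

lemma loop_free_search [simp]: "loop_free (search d D As)"
  by (induction As) (auto simp: emit_cut_def)

lemma aval_Inc_power [simp]: "aval ((Inc ^^ j) e) s = aval e s + j"
  by (induction j) auto

text \<open>Links the fixed range of \<open>D\<close> choices in the program to an adjacency list of
  unknown length at most \<open>D\<close>.\<close>

lemma map_nth_filter_upt:
  assumes "length xs \<le> D"
  shows "map ((!) xs) (filter (\<lambda>j. j < length xs \<and> P (xs ! j)) [0..<D]) = filter P xs"
proof -
  have "[0..<D] = [0..<length xs] @ [length xs..<D]"
    using assms upt_add_eq_append[of 0 "length xs" "D - length xs"] by simp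
  then have "filter (\<lambda>j. j < length xs \<and> P (xs ! j)) [0..<D] =
      filter (\<lambda>j. P (xs ! j)) [0..<length xs]"
    by (auto intro: filter_cong)
  moreover have "filter P xs = filter P (map ((!) xs) [0..<length xs])" by (simp add: map_nth)
  ultimately show ?thesis by (simp add: filter_map comp_def)
qed

lemma distinct_concat_pairs:
  "distinct vs \<Longrightarrow> (\<And>v. v \<in> set vs \<Longrightarrow> distinct (f v)) \<Longrightarrow>
    distinct (concat (map (\<lambda>v. map (Pair v) (f v)) vs))"
  by (induction vs) (auto simp: distinct_map inj_on_def)

section \<open>Correctness of the search on adjacency lists\<close>

locale adjacency_input = sgraph V E for V :: "nat set" and E +
  fixes adj :: "nat list list" and D :: nat
  assumes adjacency: "adjacency_lists adj V E"
    and nonempty: "adj \<noteq> []"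
    and degree_bound: "\<And>v. card (nbrs E v) \<le> D"
begin

definition vval :: "nat list \<Rightarrow> nat" where
  "vval p = aval (vertex p) (input_state adj)"

definition vok :: "nat list \<Rightarrow> bool" where
  "vok p \<longleftrightarrow> bval (valid p) (input_state adj)"

text \<open>The invariant of emission, which writes only to \<open>k\<close>, \<open>src\<close> and
  \<open>dst\<close>: addresses keep the values they have in the input state.\<close>

definition agrees :: "state \<Rightarrow> bool" where
  "agrees s \<longleftrightarrow> snd s ''off'' = snd (input_state adj) ''off'' \<and>
     snd s ''nbr'' = snd (input_state adj) ''nbr''"

lemma V_eq: "V = {..<length adj}"
  using adjacency by (simp add: adjacency_lists_def)

lemma set_adj: "v < length adj \<Longrightarrow> set (adj ! v) = nbrs E v"
  using adjacency by (simp add: adjacency_lists_def)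

lemma distinct_adj: "v < length adj \<Longrightarrow> distinct (adj ! v)"
  using adjacency by (simp add: adjacency_lists_def)

lemma length_adj: "v < length adj \<Longrightarrow> length (adj ! v) \<le> D"
  using distinct_card[OF distinct_adj] set_adj degree_bound by metis

lemma off_input: "v \<le> length adj \<Longrightarrow> snd (input_state adj) ''off'' v = length (concat (take v adj))"
  by (simp add: input_state_def)

lemma nbr_input:
  assumes "v < length adj" "j < length (adj ! v)"
  shows "snd (input_state adj) ''nbr'' (length (concat (take v adj)) + j) = adj ! v ! j"
proof -
  have "concat adj = concat (take v adj) @ adj ! v @ concat (drop (Suc v) adj)"
    using id_take_nth_drop[OF assms(1)] by (metis concat.simps(2) concat_append)
  then show ?thesis using assms(2) by (simp add: input_state_def nth_append)
qed

text \<open>Evaluating \<open>j # p\<close> requires that \<open>p\<close> denotes a vertex, and the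
  result is again a vertex, being an entry of an adjacency list; hence one joint induction.\<close>

lemma vok_vval:
  shows vok_less: "vok p \<Longrightarrow> vval p < length adj"
    and vok_Cons: "vok (j # p) \<longleftrightarrow> vok p \<and> j < length (adj ! vval p)"
    and vval_Cons: "vok (j # p) \<Longrightarrow> vval (j # p) = adj ! vval p ! j"
proof -
  have step: "(vok (j # p) \<longleftrightarrow> vok p \<and> j < length (adj ! vval p)) \<and>
      (vok (j # p) \<longrightarrow> vval (j # p) = adj ! vval p ! j)"
    if "vok p \<longrightarrow> vval p < length adj" for j p
    using that by (auto simp: vok_def vval_def off_input take_Suc_conv_app_nth nbr_input)
  have less: "vok p \<longrightarrow> vval p < length adj" for p
  proof (induction p)
    case Nil
    then show ?case using nonempty by (simp add: vval_def)
  next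
    case (Cons j p)
    show ?case
    proof
      assume ok: "vok (j # p)"
      then have "vok p" "j < length (adj ! vval p)" "vval (j # p) = adj ! vval p ! j"
        using step[OF Cons.IH] by auto
      then have "vval (j # p) \<in> nbrs E (vval p)" using Cons.IH set_adj by (metis nth_mem)
      then show "vval (j # p) < length adj" using nbrs_subset V_eq by auto
    qed
  qed
  show "vok p \<Longrightarrow> vval p < length adj" using less by simp
  show "vok (j # p) \<longleftrightarrow> vok p \<and> j < length (adj ! vval p)" using step[OF less] by simp
  show "vok (j # p) \<Longrightarrow> vval (j # p) = adj ! vval p ! j" using step[OF less] by simp
qed

lemma ball_address:
  "v \<in> ball E 0 i \<Longrightarrow> \<exists>p. length p \<le> i \<and> set p \<subseteq> {..<D} \<and> vok p \<and> vval p = v"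
proof (induction i arbitrary: v)
  case 0
  then show ?case by (intro exI[of _ "[]"]) (auto simp: vok_def vval_def)
next
  case (Suc i)
  from Suc.prems consider "v \<in> ball E 0 i" | u where "u \<in> ball E 0 i" "v \<in> nbrs E u" by auto
  then show ?case
  proof cases
    case 1
    then show ?thesis using Suc.IH le_SucI by blast
  next
    case 2
    with Suc.IH obtain p where p: "length p \<le> i" "set p \<subseteq> {..<D}" "vok p" "vval p = u" by blast
    have u: "u < length adj" using vok_less[OF p(3)] p(4) by simp
    with 2 obtain j where j: "j < length (adj ! u)" "adj ! u ! j = v"
      using set_adj by (metis in_set_conv_nth)
    then have "vok (j # p)" using p by (simp add: vok_Cons)
    moreover from this have "vval (j # p) = v" using vval_Cons p j by simp
    ultimately show ?thesis
      using p j length_adj[OF u] by (intro exI[of _ "j # p"]) auto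
  qed
qed

lemma agrees_eval:
  assumes "agrees s"
  shows "aval (vertex p) s = vval p" "bval (valid p) s \<longleftrightarrow> vok p"
proof -
  show *: "aval (vertex p) s = vval p" for p
    using assms by (induction p) (auto simp: agrees_def vval_def)
  show "bval (valid p) s \<longleftrightarrow> vok p"
    using assms * by (induction p) (auto simp: agrees_def vok_def vval_def)
qed

lemma agrees_tests:
  assumes "agrees s"
  shows "bval (differs A p) s \<longleftrightarrow> vval p \<notin> vval ` set A"
    "bval (outside A p) s \<longleftrightarrow> vok p \<and> vval p \<notin> vval ` set A"
    "bval (inside A p) s \<longleftrightarrow> vok p \<and> vval p \<in> vval ` set A"
    "bval (distinct_vertices A) s \<longleftrightarrow> distinct (map vval A)"
proof -
  show *: "bval (differs A p) s \<longleftrightarrow> vval p \<notin> vval ` set A" for A p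
    by (auto simp: differs_def agrees_eval[OF assms])
  show "bval (outside A p) s \<longleftrightarrow> vok p \<and> vval p \<notin> vval ` set A"
    "bval (inside A p) s \<longleftrightarrow> vok p \<and> vval p \<in> vval ` set A"
    by (simp_all add: outside_def inside_def * agrees_eval[OF assms])
  show "bval (distinct_vertices A) s \<longleftrightarrow> distinct (map vval A)"
    by (induction A) (auto simp: *)
qed

lemma agrees_input: "agrees (input_state adj)"
  by (simp add: agrees_def)

text \<open>An equality of lists rather than sets: its length gives the counts in the cut test, and
  the list itself gives the emitted edges.\<close>

lemma nbr_addresses:
  assumes "vok p"
  shows "map (\<lambda>j. vval (j # p)) (filter (\<lambda>j. vok (j # p) \<and> P (vval (j # p))) [0..<D]) =
    filter P (adj ! vval p)"
proof -
  let ?xs = "adj ! vval p"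
  have "filter (\<lambda>j. vok (j # p) \<and> P (vval (j # p))) [0..<D] =
      filter (\<lambda>j. j < length ?xs \<and> P (?xs ! j)) [0..<D]"
    using assms vval_Cons[of _ p] by (intro filter_cong) (auto simp: vok_Cons)
  moreover have "map (\<lambda>j. vval (j # p)) (filter (\<lambda>j. j < length ?xs \<and> P (?xs ! j)) [0..<D]) =
      map ((!) ?xs) (filter (\<lambda>j. j < length ?xs \<and> P (?xs ! j)) [0..<D])"
    using assms vval_Cons[of _ p] by (intro map_cong) (auto simp: vok_Cons)
  ultimately show ?thesis
    using map_nth_filter_upt[OF length_adj[OF vok_less[OF assms]], of P] by simp
qed

lemma count_nbr_addresses:
  assumes "vok p"
  shows "length (filter (\<lambda>j. vok (j # p) \<and> P (vval (j # p))) [0..<D]) =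
    card {u \<in> nbrs E (vval p). P u}"
proof -
  have "length (filter (\<lambda>j. vok (j # p) \<and> P (vval (j # p))) [0..<D]) =
      length (filter P (adj ! vval p))"
    using arg_cong[OF nbr_addresses[OF assms], of length P] by simp
  also have "\<dots> = card (set (filter P (adj ! vval p)))"
    using distinct_adj[OF vok_less[OF assms]] by (intro distinct_card[symmetric]) simp
  also have "set (filter P (adj ! vval p)) = {u \<in> nbrs E (vval p). P u}"
    using set_adj[OF vok_less[OF assms]] by auto
  finally show ?thesis .
qed

lemma nbr_address:
  assumes "vok p" "u \<in> nbrs E (vval p)"
  obtains j where "j < D" "vok (j # p)" "vval (j # p) = u"
proof -
  have less: "vval p < length adj" using assms(1) by (rule vok_less)
  with assms(2) obtain j where j: "j < length (adj ! vval p)" "adj ! vval p ! j = u"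
    using set_adj by (metis in_set_conv_nth)
  then have "vok (j # p)" using assms(1) by (simp add: vok_Cons)
  with j vval_Cons[of j p] length_adj[OF less] show ?thesis by (intro that[of j]) auto
qed

lemma vval_Cons_nbr: "vok (j # p) \<Longrightarrow> vval (j # p) \<in> nbrs E (vval p)"
  using vval_Cons[of j p] vok_Cons[of j p] set_adj[OF vok_less[of p]] by (metis nth_mem)

text \<open>Distinct values make \<open>length A\<close> the size of the candidate side, so the
  comparison with \<open>n\<close> tests properness.\<close>

lemma cut_test_iff:
  assumes "A \<noteq> []"
  shows "bval (cut_test d D A) (input_state adj) \<longleftrightarrow>
    (\<forall>p\<in>set A. vok p) \<and> distinct (map vval A) \<and> cut_side d V E (vval ` set A)"
proof -
  define B where "B = vval ` set A"
  have cV: "card V = length adj" "fst (input_state adj) ''n'' = length adj"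
    by (simp_all add: V_eq input_state_def)
  have test: "bval (cut_test d D A) (input_state adj) \<longleftrightarrow>
      (\<forall>p\<in>set A. vok p) \<and> distinct (map vval A) \<and> length A < length adj \<and>
      (\<forall>p\<in>set A. length (filter (\<lambda>j. vok (j # p) \<and> vval (j # p) \<notin> B) [0..<D]) \<le> d) \<and>
      (\<forall>p\<in>set A. \<forall>j\<in>{0..<D}. vok (j # p) \<longrightarrow> vval (j # p) \<in> B \<or>
        length (filter (\<lambda>i. vok (i # j # p) \<and> vval (i # j # p) \<in> B) [0..<D]) \<le> d)"
    by (simp add: cut_test_def agrees_eval[OF agrees_input] agrees_tests[OF agrees_input]
        ball_Un filter_map comp_def cV B_def[symmetric] conj_ac)
  show ?thesis
  proof (cases "(\<forall>p\<in>set A. vok p) \<and> distinct (map vval A)")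
    case False
    then show ?thesis using test by blast
  next
    case True
    have BV: "B \<subseteq> V" using True vok_less V_eq by (auto simp: B_def)
    have cB: "card B = length A" using True distinct_card[of "map vval A"] by (simp add: B_def)
    have out: "length (filter (\<lambda>j. vok (j # p) \<and> vval (j # p) \<notin> B) [0..<D]) =
        card (nbrs E (vval p) - B)" if "vok p" for p
      using count_nbr_addresses[OF that, of "\<lambda>u. u \<notin> B"] by (simp add: set_diff_eq)
    have ins: "length (filter (\<lambda>j. vok (j # p) \<and> vval (j # p) \<in> B) [0..<D]) =
        card (nbrs E (vval p) \<inter> B)" if "vok p" for p
      using count_nbr_addresses[OF that, of "\<lambda>u. u \<in> B"] by (simp add: Int_def)
    have "bval (cut_test d D A) (input_state adj) \<longleftrightarrow> length A < length adj \<and>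
        (\<forall>p\<in>set A. card (nbrs E (vval p) - B) \<le> d) \<and>
        (\<forall>p\<in>set A. \<forall>j\<in>{0..<D}. vok (j # p) \<longrightarrow> vval (j # p) \<in> B \<or>
          length (filter (\<lambda>i. vok (i # j # p) \<and> vval (i # j # p) \<in> B) [0..<D]) \<le> d)"
      using True out test by simp
    also have "(\<forall>p\<in>set A. \<forall>j\<in>{0..<D}. vok (j # p) \<longrightarrow> vval (j # p) \<in> B \<or>
          length (filter (\<lambda>i. vok (i # j # p) \<and> vval (i # j # p) \<in> B) [0..<D]) \<le> d) \<longleftrightarrow>
        (\<forall>u\<in>V - B. card (nbrs E u \<inter> B) \<le> d)" (is "?L \<longleftrightarrow> ?R")
    proof
      assume L: ?L
      show ?R
      proof
        fix u assume u: "u \<in> V - B"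
        show "card (nbrs E u \<inter> B) \<le> d"
        \<comment> \<open>The test visits only outside vertices adjacent to \<open>B\<close>; for
          any other vertex the bound is trivial.\<close>
        proof (cases "nbrs E u \<inter> B = {}")
          case False
          then obtain p where p: "p \<in> set A" "vval p \<in> nbrs E u" by (auto simp: B_def)
          then have "u \<in> nbrs E (vval p)" using nbrs_sym by fast
          with p True obtain j where j: "j < D" "vok (j # p)" "vval (j # p) = u"
            using nbr_address by metis
          have "length (filter (\<lambda>i. vok (i # j # p) \<and> vval (i # j # p) \<in> B) [0..<D]) \<le> d"
            using L[rule_format, of p j] p j u by auto
          then show ?thesis unfolding ins[OF j(2)] j(3) .
        qed simp
      qed
    next
      assume R: ?R
      show ?L
      proof (intro ballI impI)
        fix p j assume ok: "vok (j # p)"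
        have "card (nbrs E (vval (j # p)) \<inter> B) \<le> d" if "vval (j # p) \<notin> B"
          using R that vok_less[OF ok] V_eq by blast
        then show "vval (j # p) \<in> B \<or>
            length (filter (\<lambda>i. vok (i # j # p) \<and> vval (i # j # p) \<in> B) [0..<D]) \<le> d"
          unfolding ins[OF ok] by blast
      qed
    qed
    also have "length A < length adj \<and> (\<forall>p\<in>set A. card (nbrs E (vval p) - B) \<le> d) \<and> ?R \<longleftrightarrow>
        cut_side d V E B"
      using BV cB cV assms by (auto simp: cut_side_def B_def)
    finally show ?thesis using True by (simp add: B_def)
  qed
qed

text \<open>Stated for an arbitrary initial \<open>k\<close> and with all entries below
  \<open>k\<close> preserved, so that in the induction the entry just written survives the remaining
  run.\<close>

lemma exec_emit:
  fixes A defines "ed \<equiv> \<lambda>q. (vval (tl q), vval q)"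
    and "out \<equiv> \<lambda>q. vok q \<and> vval q \<notin> vval ` set A"
  assumes "agrees s"
  shows "\<exists>T s'. exec (emit A qs) s T s' \<and>
    fst s' ''k'' = fst s ''k'' + length (filter out qs) \<and>
    (\<forall>i<fst s ''k''. snd s' ''src'' i = snd s ''src'' i \<and> snd s' ''dst'' i = snd s ''dst'' i) \<and>
    (\<forall>i<length (filter out qs). (snd s' ''src'' (fst s ''k'' + i), snd s' ''dst'' (fst s ''k'' + i)) =
       map ed (filter out qs) ! i)"
  using assms(3)
proof (induction qs arbitrary: s)
  case Nil
  then show ?case using exec.Skip by fastforce
next
  case (Cons q qs)
  have b: "bval (outside A q) s \<longleftrightarrow> out q"
    using agrees_tests(2)[OF Cons.prems] by (simp add: out_def)
  show ?case
  proof (cases "out q")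
    case False
    from Cons.IH[OF Cons.prems] obtain T s' where
      *: "exec (emit A qs) s T s'" "fst s' ''k'' = fst s ''k'' + length (filter out qs)"
      "\<forall>i<fst s ''k''. snd s' ''src'' i = snd s ''src'' i \<and> snd s' ''dst'' i = snd s ''dst'' i"
      "\<forall>i<length (filter out qs). (snd s' ''src'' (fst s ''k'' + i), snd s' ''dst'' (fst s ''k'' + i)) =
         map ed (filter out qs) ! i" by blast
    obtain T' where "exec (emit A (q # qs)) s T' s'"
      using False b *(1) unfolding emit.simps by (meson exec.Seq exec.IfFalse exec.Skip)
    with *(2-) False show ?thesis by (intro exI[of _ T'] exI[of _ s']) (simp del: emit.simps)
  next
    case True
    define k where "k = fst s ''k''"
    define s1 where "s1 = (fst s, (snd s)(''src'' := (snd s ''src'')(k := vval (tl q))))"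
    define s2 where "s2 = (fst s1, (snd s1)(''dst'' := (snd s1 ''dst'')(k := vval q)))"
    define s3 where "s3 = ((fst s2)(''k'' := Suc k), snd s2)"
    have ag1: "agrees s1" using Cons.prems by (simp add: agrees_def s1_def)
    have "agrees s3" using ag1 by (simp add: agrees_def s3_def s2_def)
    from Cons.IH[OF this] obtain T s' where
      *: "exec (emit A qs) s3 T s'" "fst s' ''k'' = fst s3 ''k'' + length (filter out qs)"
      "\<forall>i<fst s3 ''k''. snd s' ''src'' i = snd s3 ''src'' i \<and> snd s' ''dst'' i = snd s3 ''dst'' i"
      "\<forall>i<length (filter out qs). (snd s' ''src'' (fst s3 ''k'' + i), snd s' ''dst'' (fst s3 ''k'' + i)) =
         map ed (filter out qs) ! i" by blast
    have "\<exists>T. exec (Put ''src'' (Var ''k'') (vertex (tl q))) s T s1"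
      using exec.Put[of "''src''" "Var ''k''" "vertex (tl q)" s] agrees_eval(1)[OF Cons.prems]
      by (auto simp: s1_def k_def)
    moreover have "\<exists>T. exec (Put ''dst'' (Var ''k'') (vertex q)) s1 T s2"
      using exec.Put[of "''dst''" "Var ''k''" "vertex q" s1] agrees_eval(1)[OF ag1]
      by (auto simp: s2_def s1_def k_def)
    moreover have "\<exists>T. exec (Assign ''k'' (Inc (Var ''k''))) s2 T s3"
      using exec.Assign[of "''k''" "Inc (Var ''k'')" s2]
      by (auto simp: s3_def s2_def s1_def k_def)
    ultimately have "\<exists>T. exec (emit A (q # qs)) s T s'"
      using True b *(1) unfolding emit.simps by (meson exec.Seq exec.IfTrue)
    then obtain T' where "exec (emit A (q # qs)) s T' s'" by blast
    moreover have s3: "fst s3 ''k'' = Suc k" "snd s3 ''src'' = (snd s ''src'')(k := vval (tl q))"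
      "snd s3 ''dst'' = (snd s ''dst'')(k := vval q)"
      by (auto simp: s3_def s2_def s1_def)
    moreover have "(snd s' ''src'' (k + i), snd s' ''dst'' (k + i)) =
        map ed (filter out (q # qs)) ! i" if "i < length (filter out (q # qs))" for i
    proof (cases i)
      case 0
      then show ?thesis using *(3) s3 True by (simp add: ed_def)
    next
      case (Suc i')
      then show ?thesis using *(4) s3 True that by simp
    qed
    ultimately show ?thesis
      using *(2,3) True by (intro exI[of _ T'] exI[of _ s']) (auto simp: k_def[symmetric])
  qed
qed

lemma exec_emit_cut:
  assumes ok: "\<forall>p\<in>set A. vok p" and dist: "distinct (map vval A)"
  defines "B \<equiv> vval ` set A"
  shows "\<exists>T s. exec (emit_cut D A) (input_state adj) T s \<and>
    outputs_edges s {e \<in> E. \<exists>b\<in>B. \<exists>u\<in>V - B. e = {b, u}}"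
proof -
  define qs where "qs = concat (map (\<lambda>p. map (\<lambda>j. j # p) [0..<D]) A)"
  define out where "out q \<longleftrightarrow> vok q \<and> vval q \<notin> B" for q
  define L where "L = map (\<lambda>q. (vval (tl q), vval q)) (filter out qs)"
  have step: "map (\<lambda>q. (vval (tl q), vval q)) (filter out (map (\<lambda>j. j # p) [0..<D])) =
      map (Pair (vval p)) (filter (\<lambda>u. u \<notin> B) (adj ! vval p))" if "vok p" for p
    using nbr_addresses[OF that, of "\<lambda>u. u \<notin> B", symmetric]
    by (simp add: filter_map comp_def out_def)
  have "map (\<lambda>q. (vval (tl q), vval q))
        (filter out (concat (map (\<lambda>p. map (\<lambda>j. j # p) [0..<D]) A'))) =
      concat (map (\<lambda>v. map (Pair v) (filter (\<lambda>u. u \<notin> B) (adj ! v))) (map vval A'))"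
    if "\<forall>p\<in>set A'. vok p" for A'
    using that
  proof (induction A')
    case (Cons p A')
    then show ?case using step[of p] by simp
  qed simp
  from this[OF ok]
  have "L = concat (map (\<lambda>v. map (Pair v) (filter (\<lambda>u. u \<notin> B) (adj ! v))) (map vval A))"
    by (simp add: L_def qs_def)
  moreover have "v < length adj" if "v \<in> set (map vval A)" for v
    using that ok vok_less by auto
  ultimately have L: "distinct L" "set L = {(v, u). v \<in> B \<and> u \<in> nbrs E v - B}"
    using distinct_concat_pairs[OF dist, of "\<lambda>v. filter (\<lambda>u. u \<notin> B) (adj ! v)"]
    by (auto simp: B_def distinct_adj set_adj)
  define M where "M = {e \<in> E. \<exists>b\<in>B. \<exists>u\<in>V - B. e = {b, u}}"
  have M: "M = (\<lambda>(v, u). {v, u}) ` set L"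
    using edge_in_V by (force simp: M_def L(2) nbrs_def)
  \<comment> \<open>Each pair in \<open>L\<close> points from \<open>B\<close> to its outside, so no
    edge occurs in both orientations.\<close>
  have "inj_on (\<lambda>(v, u). {v, u}) (set L)"
    by (auto simp: inj_on_def L(2) doubleton_eq_iff)
  then have cM: "card M = length L"
    using M distinct_card[OF L(1)] by (simp add: card_image)
  from exec_emit[OF agrees_input, of A qs] obtain T s where
    s: "exec (emit A qs) (input_state adj) T s" "fst s ''k'' = length L"
    "\<And>i. i < length L \<Longrightarrow> (snd s ''src'' i, snd s ''dst'' i) = L ! i"
    by (auto simp: L_def out_def[abs_def] B_def input_state_def)
  have "M = {{snd s ''src'' i, snd s ''dst'' i} | i. i < length L}"
  proof -
    have "M = {(\<lambda>(v, u). {v, u}) (L ! i) | i. i < length L}"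
      unfolding M set_conv_nth by blast
    also have "\<dots> = {{snd s ''src'' i, snd s ''dst'' i} | i. i < length L}"
      using s(3)[symmetric] by (metis (no_types, lifting) case_prod_conv)
    finally show ?thesis .
  qed
  then show ?thesis
    using s(1,2) cM unfolding M_def[symmetric] emit_cut_def qs_def[symmetric]
    by (intro exI[of _ T] exI[of _ s]) (simp add: outputs_edges_def)
qed

text \<open>Failed tests leave the state unchanged, and by \<open>cut_test_iff\<close> the first
  candidate that passes is one side of a d-cut.\<close>

lemma exec_search:
  assumes "[] \<notin> set As" "\<exists>A\<in>set As. bval (cut_test d D A) (input_state adj)"
  shows "\<exists>T s M. exec (search d D As) (input_state adj) T s \<and> outputs_edges s M \<and> d_cut d V E M"
  using assms
proof (induction As)
  case (Cons A As)
  show ?case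
  proof (cases "bval (cut_test d D A) (input_state adj)")
    case True
    then have "\<forall>p\<in>set A. vok p" "distinct (map vval A)" "cut_side d V E (vval ` set A)"
      using cut_test_iff[of A d] Cons.prems by auto
    from exec_emit_cut[OF this(1,2)] d_cut_if_cut_side[OF simple this(3)] obtain T s M where
      "exec (emit_cut D A) (input_state adj) T s" "outputs_edges s M" "d_cut d V E M" by blast
    then show ?thesis using exec.IfTrue[OF True] unfolding search.simps by blast
  next
    case False
    with Cons obtain T s M where
      "exec (search d D As) (input_state adj) T s" "outputs_edges s M" "d_cut d V E M" by auto
    then show ?thesis using exec.IfFalse[OF False] unfolding search.simps by blast
  qed
qed simp

end

section \<open>One loop-free program for all admissible graphs\<close>

lemma linear_time_admissible:
  assumes d: "d \<ge> 2" and t: "t \<ge> 2"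
  shows "linear_time_edge_search (admissible d t l) (d_cut d)"
proof -
  define D where "D = 2 * d + 1"
  define N where "N = Suc l + d * (2 * d + 1) ^ (l + 2)"
  define K where "K = (d + 1) * (2 * d + 1) ^ (l + 2)"
  define addr where "addr = {p. set p \<subseteq> {..<D} \<and> length p \<le> N}"
  \<comment> \<open>Finitely many candidates, fixed by d and l before the input is known. The empty
    list is removed because a side must be nonempty; repeated vertices are rejected by the
    test.\<close>
  define cands where "cands = {A. set A \<subseteq> addr \<and> length A \<le> K} - {[]}"
  have "finite addr" unfolding addr_def by (rule finite_lists_length_le) simp
  then have "finite cands" unfolding cands_def by (intro finite_Diff finite_lists_length_le)
  then obtain As where As: "set As = cands" using finite_list by blast
  have main: "\<exists>T s M. exec (search d D As) (input_state adj) T s \<and>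
      T \<le> max_time (search d D As) * (card V + card E) \<and> outputs_edges s M \<and> d_cut d V E M"
    if G: "simple_graph V E" "adjacency_lists adj V E" "admissible d t l V E" for adj V E
  proof -
    interpret g: sgraph V E by standard fact
    note deg = admissible_max_degree[OF G(3) d t]
    have "V \<noteq> {}" using deg(1) by (auto simp: max_degree_def)
    then have ne: "adj \<noteq> []" "0 \<in> V" using G(2) by (auto simp: adjacency_lists_def)
    interpret adjacency_input V E adj D
      by unfold_locales (use G ne order_trans[OF g.card_nbrs_le deg(2)] in \<open>simp_all add: D_def\<close>)
    obtain B where B: "cut_side d V E B" "B \<subseteq> ball E 0 N" "card B \<le> K"
      using admissible_cut_side[OF G(3) d t ne(2)] unfolding N_def K_def by blast
    have "\<forall>v\<in>B. \<exists>p. length p \<le> N \<and> set p \<subseteq> {..<D} \<and> vok p \<and> vval p = v"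
      using ball_address B(2) by blast
    from bchoice[OF this] obtain f where
      f: "\<forall>v\<in>B. length (f v) \<le> N \<and> set (f v) \<subseteq> {..<D} \<and> vok (f v) \<and> vval (f v) = v"
      by blast
    have "finite B" using B(1) g.finite_V finite_subset by (auto simp: cut_side_def)
    then obtain bs where bs: "set bs = B" "distinct bs" using finite_distinct_list by blast
    \<comment> \<open>One address per vertex of the side \<open>B\<close>: this candidate passes the
      test.\<close>
    define A where "A = map f bs"
    have vA: "map vval A = bs" using f bs(1) by (auto simp: A_def intro: map_idI)
    then have "vval ` set A = B" using bs(1) by (metis set_map)
    moreover have "A \<noteq> []" using B(1) bs(1) by (auto simp: A_def cut_side_def)
    ultimately have "bval (cut_test d D A) (input_state adj)"
      using cut_test_iff[of A d] B(1) bs f vA by (auto simp: A_def)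
    moreover have "A \<in> set As"
      using As \<open>A \<noteq> []\<close> f bs B(3) distinct_card[OF bs(2)]
      by (auto simp: cands_def addr_def A_def)
    ultimately obtain T s M where TsM: "exec (search d D As) (input_state adj) T s"
      "outputs_edges s M" "d_cut d V E M"
      using exec_search[of As d] As by (auto simp: cands_def)
    have "T \<le> max_time (search d D As)" using exec_max_time[OF TsM(1)] by simp
    \<comment> \<open>Turns the constant time bound into a linear one.\<close>
    moreover have "card V \<ge> 1" using ne(2) g.finite_V by (metis One_nat_def Suc_leI card_gt_0_iff empty_iff)
    ultimately have "T \<le> max_time (search d D As) * (card V + card E)"
      by (metis le_add1 mult.right_neutral mult_le_mono2 order_trans)
    with TsM show ?thesis by blast
  qed
  show ?thesis
    unfolding linear_time_edge_search_def
    using main by (intro exI[of _ "search d D As"] exI[of _ "max_time (search d D As)"]) blast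
qed

theorem theorem3p2:
  fixes d t l :: nat
  assumes "d \<ge> 2" and "t \<ge> 2" and "l \<ge> 1"
  shows "(\<forall>(V :: 'a set) E. admissible d t l V E \<longrightarrow> (\<exists>M. d_cut d V E M)) \<and>
         linear_time_edge_search (admissible d t l) (d_cut d)"
proof (intro conjI allI impI)
  fix V :: "'a set" and E
  assume adm: "admissible d t l V E"
  have "V \<noteq> {}"
    using admissible_max_degree(1)[OF adm assms(1,2)] by (auto simp: max_degree_def)
  \<comment> \<open>For existence any vertex serves as the centre; the program uses vertex
    0.\<close>
  then obtain r where "r \<in> V" by blast
  then obtain B where "cut_side d V E B" using admissible_cut_side[OF adm assms(1,2)] by metis
  then show "\<exists>M. d_cut d V E M"
    using d_cut_if_cut_side adm unfolding admissible_def by blast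
qed (rule linear_time_admissible[OF assms(1,2)])

end
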